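(* Let $W_1,W_2,W_3,W_4$ be four distinct equi-isoclinic planes in $\mathbb{R}^4$, and for each $m\in\{1,2,3,4\}$ let $v_{3m-2},v_{3m-1},v_{3m}$ be a Mercedes-Benz frame (of unit vectors) lying in $W_m$. Then the sequence $(v_j)_{j=1}^{12}$ is a $12$-vector spherical $(2,2)$-design for $\mathbb{R}^4$.
   Context: Spherical designs: for $t\in\{1,2,\ldots\}$, a sequence of vectors $v_1,\ldots,v_n\in\mathbb{R}^d$, not all zero, is a spherical $(t,t)$-design for $\mathbb{R}^d$ if $$\sum_{j=1}^n\sum_{k=1}^n |\langle v_j,v_k\rangle|^{2t} = \frac{1\cdot 3\cdot 5\cdots(2t-1)}{d(d+2)\cdots(d+2(t-1))}\Bigl(\sum_{\ell=1}^n\|v_\ell\|^{2t}\Bigr)^2 .$$ (The left-hand side is always $\ge$ the right-hand side.) Equi-isoclinic planes: $2$-dimensional subspaces $W_1,\ldots,W_4$ of $\mathbb{R}^4$, with orthogonal projections $P_1,\ldots,P_4$ onto them, are equi-isoclinic if there is a single $\sigma$ such that $P_jP_kP_j=\sigma^2P_j$ for all $j\neq k$. Mercedes-Benz frame: a set of three equiangular vectors/lines in a $2$-dimensional subspace, i.e. three unit vectors $u_1,u_2,u_3$ in a $2$-dimensional subspace which span three distinct lines and for which $|\langle u_j,u_k\rangle|$, $j\ne k$, are all equal. *)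

theory Defs
  imports "HOL-Analysis.Analysis"
begin

text \<open>A sequence \<open>v 1, \<dots>, v n\<close>; values of \<open>v\<close> outside \<open>{1..n}\<close> are irrelevant. The constant is
  \<open>1 \<cdot> 3 \<cdots> (2t - 1) / (d (d + 2) \<cdots> (d + 2(t - 1)))\<close>.\<close>

definition spherical_tt_design :: "nat \<Rightarrow> nat \<Rightarrow> (nat \<Rightarrow> real ^ 'd) \<Rightarrow> bool" where
  "spherical_tt_design t n v \<longleftrightarrow>
     t \<ge> 1 \<and> (\<exists>j\<in>{1..n}. v j \<noteq> 0) \<and>
     (\<Sum>j=1..n. \<Sum>k=1..n. \<bar>v j \<bullet> v k\<bar> ^ (2 * t)) =
       (\<Prod>i<t. 2 * real i + 1) / (\<Prod>i<t. real CARD('d) + 2 * real i) *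
       (\<Sum>l=1..n. norm (v l) ^ (2 * t))\<^sup>2"

text \<open>The description is only meaningful when \<open>W\<close> is a subspace; see \<open>orth_proj_unique_existence\<close>.\<close>

definition orth_proj :: "(real ^ 'd) set \<Rightarrow> real ^ 'd \<Rightarrow> real ^ 'd" where
  "orth_proj W x = (THE p. p \<in> W \<and> (\<forall>w\<in>W. orthogonal (x - p) w))"

lemma orth_proj_unique_existence:
  fixes W :: "(real ^ 'd) set"
  assumes "subspace W"
  shows "\<exists>!p. p \<in> W \<and> (\<forall>w\<in>W. orthogonal (x - p) w)"
proof (rule ex_ex1I)
  obtain y z where "y \<in> span W" "\<And>w. w \<in> span W \<Longrightarrow> orthogonal z w" "x = y + z"
    using orthogonal_subspace_decomp_exists by metis
  then show "\<exists>p. p \<in> W \<and> (\<forall>w\<in>W. orthogonal (x - p) w)"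
    using assms by (intro exI[of _ y]) (auto simp: span_eq_iff[THEN iffD2])
next
  fix p q
  assume p: "p \<in> W \<and> (\<forall>w\<in>W. orthogonal (x - p) w)"
    and q: "q \<in> W \<and> (\<forall>w\<in>W. orthogonal (x - q) w)"
  then have "p - q \<in> W" using assms by (simp add: subspace_diff)
  then have "(x - q) \<bullet> (p - q) = 0" "(x - p) \<bullet> (p - q) = 0"
    using p q by (auto simp: orthogonal_def)
  then have "(p - q) \<bullet> (p - q) = 0" by (simp add: inner_diff_left)
  then show "p = q" by simp
qed

definition equi_isoclinic_planes :: "'i set \<Rightarrow> ('i \<Rightarrow> (real ^ 'd) set) \<Rightarrow> bool" where
  "equi_isoclinic_planes I W \<longleftrightarrow>
     (\<forall>j\<in>I. subspace (W j) \<and> dim (W j) = 2) \<and>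
     (\<exists>\<sigma>::real. \<forall>j\<in>I. \<forall>k\<in>I. j \<noteq> k \<longrightarrow>
        orth_proj (W j) \<circ> orth_proj (W k) \<circ> orth_proj (W j) =
        (\<lambda>x. \<sigma>\<^sup>2 *\<^sub>R orth_proj (W j) x))"

definition mercedes_benz_frame ::
  "(real ^ 'd) set \<Rightarrow> real ^ 'd \<Rightarrow> real ^ 'd \<Rightarrow> real ^ 'd \<Rightarrow> bool" where
  "mercedes_benz_frame W u1 u2 u3 \<longleftrightarrow>
     subspace W \<and> dim W = 2 \<and>
     u1 \<in> W \<and> u2 \<in> W \<and> u3 \<in> W \<and>
     norm u1 = 1 \<and> norm u2 = 1 \<and> norm u3 = 1 \<and>
     span {u1} \<noteq> span {u2} \<and> span {u1} \<noteq> span {u3} \<and> span {u2} \<noteq> span {u3} \<and>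
     \<bar>u1 \<bullet> u2\<bar> = \<bar>u1 \<bullet> u3\<bar> \<and> \<bar>u1 \<bullet> u3\<bar> = \<bar>u2 \<bullet> u3\<bar>"

end

theory Submission
  imports Defs
begin

text \<open>Three mutually equiangular lines of a plane meet at angles of \<open>60\<close> degrees, so the fourth powers
  \<open>(u \<bullet> x) ^ 4\<close> over a Mercedes-Benz frame of a plane sum to \<open>9/8\<close> times \<open>norm x ^ 4\<close> for all \<open>x\<close> of the
  plane (\<open>mercedes_benz_sum_power4\<close>). For any other \<open>x\<close>, the frame only sees its projection \<open>P x\<close> onto
  the plane. If \<open>x\<close> is a unit vector of a plane \<open>isoclinic\<close> to the first one, then \<open>norm (P x)\<^sup>2 = \<sigma>\<^sup>2\<close>.
  With four planes and three vectors in each, the double sum of the design condition is therefore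
  \<open>12 \<sqdot> 9/8 \<sqdot> (1 + 3 \<sigma>\<^sup>4)\<close>, whatever the position of the frames inside their planes. The required value is
  \<open>3/24 \<sqdot> 12\<^sup>2 = 18\<close>, which is attained exactly when \<open>\<sigma>\<^sup>2 = 1/3\<close>.

  So all depends on the fact that four distinct equi-isoclinic planes of a four-dimensional space
  have \<open>\<sigma>\<^sup>2 = 1/3\<close> (\<open>four_isoclinic_planes_parameter\<close>). Write \<open>s = \<sigma>\<^sup>2\<close>; since the planes are
  distinct, \<open>s \<noteq> 1\<close>. Fix a unit vector \<open>e\<close> of one of the planes, \<open>A\<close>, and consider for the other
  three planes the vectors \<open>P e - s e\<close>. They lie in the orthogonal complement of \<open>A\<close>, which is
  two-dimensional, and have the same norm. Moreover any two of the planes span the whole space, and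
  splitting \<open>e\<close> along them shows that these three vectors also have the same mutual inner products
  (\<open>isoclinic_inner_proj\<close>). Three such vectors can only fit into a plane if they are equal or sum to
  zero (\<open>equiangular_dependent\<close>). Their Gram matrix has the eigenvalues \<open>(1 - s)/2\<close> and
  \<open>(1 - s) (3 s - 1)\<close>, hence \<open>s = 1/3\<close>.\<close>

section \<open>Orthogonal projections and isoclinic subspaces\<close>

lemma
  assumes "subspace W"
  shows orth_proj_in: "orth_proj W x \<in> W"
    and orth_proj_orthogonal: "w \<in> W \<Longrightarrow> (x - orth_proj W x) \<bullet> w = 0"
  using theI'[OF orth_proj_unique_existence[OF assms, of x]]
  unfolding orth_proj_def orthogonal_def by auto

lemma orth_proj_inner:
  assumes "subspace W" "w \<in> W"
  shows "orth_proj W x \<bullet> w = x \<bullet> w"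
  using orth_proj_orthogonal[OF assms, of x] by (simp add: inner_diff_left)

lemma orth_proj_eqI:
  assumes "subspace W" "p \<in> W" "\<And>w. w \<in> W \<Longrightarrow> (x - p) \<bullet> w = 0"
  shows "orth_proj W x = p"
  using orth_proj_unique_existence[OF assms(1), of x] assms
    orth_proj_in[OF assms(1), of x] orth_proj_orthogonal[OF assms(1), of _ x]
  by (auto simp: orthogonal_def)

lemma orth_proj_fixed: "subspace W \<Longrightarrow> x \<in> W \<Longrightarrow> orth_proj W x = x"
  by (rule orth_proj_eqI) auto

lemma orth_proj_add:
  assumes "subspace W"
  shows "orth_proj W (x + y) = orth_proj W x + orth_proj W y"
proof (rule orth_proj_eqI[OF assms])
  show "orth_proj W x + orth_proj W y \<in> W"
    using assms by (simp add: subspace_add orth_proj_in)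
  show "(x + y - (orth_proj W x + orth_proj W y)) \<bullet> w = 0" if "w \<in> W" for w
    using orth_proj_inner[OF assms that] by (simp add: inner_diff_left inner_add_left)
qed

text \<open>\<open>s\<close> is the squared cosine of the angle between \<open>U\<close> and \<open>V\<close>: every vector of \<open>U\<close> makes this
  same angle with \<open>V\<close>.\<close>

definition isoclinic :: "real \<Rightarrow> (real ^ 'd) set \<Rightarrow> (real ^ 'd) set \<Rightarrow> bool" where
  "isoclinic s U V \<longleftrightarrow>
     subspace U \<and> subspace V \<and> (\<forall>x\<in>U. orth_proj U (orth_proj V x) = s *\<^sub>R x)"

lemma isoclinicD:
  assumes "isoclinic s U V"
  shows "subspace U" "subspace V" "x \<in> U \<Longrightarrow> orth_proj U (orth_proj V x) = s *\<^sub>R x"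
  using assms by (auto simp: isoclinic_def)

lemma equi_isoclinic_planes_isoclinic:
  assumes "equi_isoclinic_planes I W"
  obtains s where "\<And>j k. j \<in> I \<Longrightarrow> k \<in> I \<Longrightarrow> j \<noteq> k \<Longrightarrow> isoclinic s (W j) (W k)"
proof -
  obtain \<sigma> :: real where \<sigma>: "\<forall>j\<in>I. \<forall>k\<in>I. j \<noteq> k \<longrightarrow>
      orth_proj (W j) \<circ> orth_proj (W k) \<circ> orth_proj (W j) = (\<lambda>x. \<sigma>\<^sup>2 *\<^sub>R orth_proj (W j) x)"
    and sub: "\<forall>j\<in>I. subspace (W j) \<and> dim (W j) = 2"
    using assms unfolding equi_isoclinic_planes_def by (elim conjE exE)
  have "isoclinic (\<sigma>\<^sup>2) (W j) (W k)" if jk: "j \<in> I" "k \<in> I" "j \<noteq> k" for j k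
  proof -
    have subs: "subspace (W j)" "subspace (W k)" using sub jk by blast+
    have "orth_proj (W j) \<circ> orth_proj (W k) \<circ> orth_proj (W j) =
        (\<lambda>x. \<sigma>\<^sup>2 *\<^sub>R orth_proj (W j) x)"
      by (rule mp[OF bspec[OF bspec[OF \<sigma> jk(1)] jk(2)] jk(3)])
    from fun_cong[OF this] have "orth_proj (W j) (orth_proj (W k) (orth_proj (W j) x)) =
        \<sigma>\<^sup>2 *\<^sub>R orth_proj (W j) x" for x
      by (simp only: comp_apply)
    then have "orth_proj (W j) (orth_proj (W k) x) = \<sigma>\<^sup>2 *\<^sub>R x" if "x \<in> W j" for x
      using orth_proj_fixed[OF subs(1) that] by metis
    then show ?thesis using subs by (simp add: isoclinic_def)
  qed
  then show thesis by (rule that)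
qed

text \<open>Since projections are self-adjoint, the projection onto \<open>V\<close> restricted to \<open>U\<close> is a similarity
  with squared factor \<open>s\<close>.\<close>

lemma isoclinic_inner:
  assumes "isoclinic s U V" "x \<in> U" "y \<in> U"
  shows "orth_proj V x \<bullet> y = s * (x \<bullet> y)"
    and "orth_proj V x \<bullet> orth_proj V y = s * (x \<bullet> y)"
proof -
  note D = isoclinicD[OF assms(1)]
  show *: "orth_proj V x \<bullet> y = s * (x \<bullet> y)"
    using orth_proj_inner[OF D(1) assms(3), of "orth_proj V x"] D(3)[OF assms(2)] by simp
  have "orth_proj V y \<bullet> orth_proj V x = y \<bullet> orth_proj V x"
    by (rule orth_proj_inner) (auto intro: D orth_proj_in)
  with * show "orth_proj V x \<bullet> orth_proj V y = s * (x \<bullet> y)" by (simp add: inner_commute)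
qed

text \<open>The parameter \<open>1\<close> means that the projection onto \<open>V\<close> preserves the norms of the vectors of \<open>U\<close>;
  by Pythagoras it then fixes them.\<close>

lemma isoclinic_1_subset:
  assumes "isoclinic 1 U V"
  shows "U \<subseteq> V"
proof
  fix x assume x: "x \<in> U"
  note D = isoclinicD[OF assms]
  let ?p = "orth_proj V x"
  have "(x - ?p) \<bullet> (x - ?p) = x \<bullet> x - 2 * (?p \<bullet> x) + ?p \<bullet> ?p"
    by (simp add: inner_diff_left inner_diff_right inner_commute)
  also have "\<dots> = 0" using isoclinic_inner[OF assms x x] by simp
  finally have "x = ?p" by simp
  then show "x \<in> V" using orth_proj_in[OF D(2)] by metis
qed

lemma isoclinic_distinct:
  assumes "isoclinic s U V" "dim U = dim V" "U \<noteq> V"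
  shows "s \<noteq> 1"
proof
  assume "s = 1"
  then have "U \<subseteq> V" using assms(1) isoclinic_1_subset by blast
  then show False
    using subspace_dim_equal isoclinicD(1,2)[OF assms(1)] assms(2,3) by fastforce
qed

text \<open>A common vector \<open>x\<close> of \<open>U\<close> and \<open>V\<close> is fixed by both projections, so that \<open>x = s x\<close>. As
  \<open>s \<noteq> 1\<close>, the subspaces meet only in \<open>0\<close>, and by their dimensions they span the whole space.\<close>

lemma isoclinic_complementary:
  fixes U V :: "(real ^ 'd) set"
  assumes iso: "isoclinic s U V" and "s \<noteq> 1" and dims: "dim U + dim V = CARD('d)"
  obtains a b where "a \<in> U" "b \<in> V" "e = a + b"
proof -
  note D = isoclinicD[OF iso]
  have "x = 0" if "x \<in> U" "x \<in> V" for x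
  proof -
    have "s *\<^sub>R x = x"
      using D(3)[OF that(1)] orth_proj_fixed[OF D(2) that(2)] orth_proj_fixed[OF D(1) that(1)]
      by simp
    then have "(s - 1) *\<^sub>R x = 0" by (simp add: scaleR_diff_left)
    then show ?thesis using \<open>s \<noteq> 1\<close> by simp
  qed
  then have "U \<inter> V \<subseteq> {0}" by blast
  then have "dim (U \<inter> V) = 0" by simp
  moreover have "dim U + dim V = DIM(real ^ 'd)" using dims by simp
  ultimately have "dim {x + y |x y. x \<in> U \<and> y \<in> V} = DIM(real ^ 'd)"
    using dim_sums_Int[OF D(1,2)] by linarith
  moreover have "subspace {x + y |x y. x \<in> U \<and> y \<in> V}"
    by (rule subspace_sums[OF D(1,2)])
  ultimately have "{x + y |x y. x \<in> U \<and> y \<in> V} = UNIV"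
    by (simp only: dim_eq_full span_eq_iff[THEN iffD2])
  then have "e \<in> {x + y |x y. x \<in> U \<and> y \<in> V}" by (simp only: UNIV_I)
  then show thesis by (elim CollectE exE conjE) (rule that)
qed

text \<open>The inner product of the two projections does not depend on \<open>e\<close> because the hypotheses force the
  components \<open>a\<close> and \<open>b\<close> of \<open>e = a + b\<close> to have the norm of \<open>e\<close> and to satisfy
  \<open>2 (a \<bullet> b) = - (e \<bullet> e)\<close>.\<close>

lemma isoclinic_inner_proj:
  fixes U V :: "(real ^ 'd) set"
  assumes UV: "isoclinic s U V" and VU: "isoclinic s V U" and "s \<noteq> 1"
    and dims: "dim U + dim V = CARD('d)"
    and eU: "orth_proj U e \<bullet> orth_proj U e = s * (e \<bullet> e)"
    and eV: "orth_proj V e \<bullet> orth_proj V e = s * (e \<bullet> e)"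
  shows "orth_proj U e \<bullet> orth_proj V e = (3 * s - 1) / 2 * (e \<bullet> e)"
proof -
  note sub = isoclinicD(1,2)[OF UV]
  obtain a b where ab: "a \<in> U" "b \<in> V" "e = a + b"
    using isoclinic_complementary[OF UV \<open>s \<noteq> 1\<close> dims] by metis
  let ?p = "orth_proj U b" and ?q = "orth_proj V a"
  have pe: "orth_proj U e = a + ?p" and qe: "orth_proj V e = ?q + b"
    using ab sub by (simp_all add: orth_proj_add orth_proj_fixed)
  have pU: "?p \<in> U" and qV: "?q \<in> V" using sub by (simp_all add: orth_proj_in)
  have pa: "?p \<bullet> a = a \<bullet> b" and qb: "?q \<bullet> b = a \<bullet> b"
    using orth_proj_inner[OF sub(1) ab(1), of b] orth_proj_inner[OF sub(2) ab(2), of a]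
    by (simp_all add: inner_commute)
  have pp: "?p \<bullet> ?p = s * (b \<bullet> b)" and pb: "?p \<bullet> b = s * (b \<bullet> b)"
    using isoclinic_inner[OF VU ab(2) ab(2)] by simp_all
  have qq: "?q \<bullet> ?q = s * (a \<bullet> a)" and qa: "?q \<bullet> a = s * (a \<bullet> a)"
    using isoclinic_inner[OF UV ab(1) ab(1)] by simp_all
  have pq: "?p \<bullet> ?q = s * (a \<bullet> b)"
    using isoclinic_inner(1)[OF UV ab(1) pU] pa by (simp add: inner_commute)
  have ee: "e \<bullet> e = a \<bullet> a + 2 * (a \<bullet> b) + b \<bullet> b"
    by (simp add: ab(3) inner_add_left inner_add_right inner_commute)
  have 1: "a \<bullet> a + 2 * (a \<bullet> b) + s * (b \<bullet> b) = s * (e \<bullet> e)"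
    using eU pa pp by (simp add: pe inner_add_left inner_add_right inner_commute)
  have 2: "s * (a \<bullet> a) + 2 * (a \<bullet> b) + b \<bullet> b = s * (e \<bullet> e)"
    using eV qb qq by (simp add: qe inner_add_left inner_add_right inner_commute)
  have "(1 - s) * (b \<bullet> b) = (1 - s) * (e \<bullet> e)" using 1 ee unfolding left_diff_distrib by linarith
  then have b: "b \<bullet> b = e \<bullet> e" using \<open>s \<noteq> 1\<close> by simp
  have "(1 - s) * (a \<bullet> a) = (1 - s) * (e \<bullet> e)" using 2 ee unfolding left_diff_distrib by linarith
  then have a: "a \<bullet> a = e \<bullet> e" using \<open>s \<noteq> 1\<close> by simp
  have c: "a \<bullet> b = - (e \<bullet> e) / 2" using ee a b by simp
  have "orth_proj U e \<bullet> orth_proj V e = s * (a \<bullet> a) + a \<bullet> b + s * (a \<bullet> b) + s * (b \<bullet> b)"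
    using qa pq pb by (simp add: pe qe inner_add_left inner_add_right inner_commute)
  then show ?thesis by (simp add: a b c field_simps)
qed

section \<open>The parameter of four equi-isoclinic planes\<close>

text \<open>The Gram matrix of the vectors \<open>f i\<close>, with \<open>N\<close> on the diagonal and \<open>M\<close> off it, has the eigenvalues
  \<open>N - M\<close> and \<open>N + (card I - 1) M\<close>. A linear dependency makes it singular.\<close>

lemma equiangular_dependent:
  fixes f :: "'i \<Rightarrow> 'a :: euclidean_space"
  assumes fin: "finite I"
    and N: "\<And>i. i \<in> I \<Longrightarrow> f i \<bullet> f i = N"
    and M: "\<And>i j. i \<in> I \<Longrightarrow> j \<in> I \<Longrightarrow> i \<noteq> j \<Longrightarrow> f i \<bullet> f j = M"
    and "N \<noteq> M" and S: "f ` I \<subseteq> S" and dim: "dim S < card I"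
  shows "N + (real (card I) - 1) * M = 0"
proof -
  have inj: "inj_on f I"
    using N M \<open>N \<noteq> M\<close> by (intro inj_onI) metis
  have "dependent (f ` I)"
    using independent_card_le_dim[OF S] dim card_image[OF inj] by auto
  then obtain u where u: "\<exists>v\<in>f ` I. u v \<noteq> 0" "(\<Sum>v\<in>f ` I. u v *\<^sub>R v) = 0"
    using dependent_finite[of "f ` I"] fin by auto
  define c where "c i = u (f i)" for i
  let ?s = "\<Sum>i\<in>I. c i"
  have zero: "(\<Sum>i\<in>I. c i *\<^sub>R f i) = 0"
    using u(2) by (simp add: sum.reindex[OF inj] c_def)
  have eig: "(N - M) * c j + M * ?s = 0" if j: "j \<in> I" for j
  proof -
    have "0 = (\<Sum>i\<in>I. c i *\<^sub>R f i) \<bullet> f j" by (simp add: zero)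
    also have "\<dots> = (\<Sum>i\<in>I. c i * (f i \<bullet> f j))" by (simp add: inner_sum_left)
    also have "\<dots> = (\<Sum>i\<in>I. M * c i + (if i = j then (N - M) * c j else 0))"
      using j N M by (intro sum.cong) (auto simp: algebra_simps)
    also have "\<dots> = M * ?s + (N - M) * c j"
      using fin j by (simp add: sum.distrib sum_distrib_left)
    finally show ?thesis by simp
  qed
  have "?s \<noteq> 0"
    using u(1) eig \<open>N \<noteq> M\<close> by (force simp: c_def)
  moreover have "(N + (real (card I) - 1) * M) * ?s = 0"
  proof -
    have "(\<Sum>j\<in>I. (N - M) * c j + M * ?s) = (\<Sum>j\<in>I. (N - M) * c j) + real (card I) * (M * ?s)"
      by (simp only: sum.distrib sum_constant)
    also have "(\<Sum>j\<in>I. (N - M) * c j) = (N - M) * ?s"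
      by (rule sum_distrib_left[symmetric])
    finally show ?thesis using eig by (simp add: algebra_simps)
  qed
  ultimately show ?thesis by simp
qed

text \<open>With \<open>N = s - s\<^sup>2\<close> and \<open>M = (3 s - 1)/2 - s\<^sup>2\<close> for the components \<open>b k\<close> of the projections orthogonal
  to the plane of \<open>e\<close>, the first eigenvalue \<open>N - M = (1 - s)/2\<close> vanishes only for coinciding planes, so
  it is the second one, \<open>N + 2 M\<close>, that determines \<open>s\<close>.\<close>

lemma four_isoclinic_planes_parameter:
  fixes W :: "'i \<Rightarrow> (real ^ 4) set"
  assumes I: "card I = 4" and inj: "inj_on W I"
    and dims: "\<And>j. j \<in> I \<Longrightarrow> dim (W j) = 2"
    and iso: "\<And>j k. j \<in> I \<Longrightarrow> k \<in> I \<Longrightarrow> j \<noteq> k \<Longrightarrow> isoclinic s (W j) (W k)"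
  shows "s = 1 / 3"
proof -
  have fin: "finite I" using I by (simp add: card_ge_0_finite)
  have "I \<noteq> {}" using I by auto
  then obtain i where i: "i \<in> I" by blast
  let ?J = "I - {i}"
  have J: "card ?J = 3" using I i fin by simp
  then have "?J \<noteq> {}" by (metis card.empty zero_neq_numeral)
  then obtain j where j: "j \<in> ?J" by blast
  have s1: "s \<noteq> 1"
  proof (rule isoclinic_distinct)
    show "isoclinic s (W i) (W j)" using iso i j by auto
    show "dim (W i) = dim (W j)" using dims i j by auto
    show "W i \<noteq> W j" using inj i j by (metis DiffE inj_onD singletonI)
  qed
  have sub: "subspace (W i)" using isoclinicD(1)[OF iso[of i j]] i j by auto
  obtain e0 where e0: "e0 \<in> W i" "e0 \<noteq> 0"
    using dims[OF i] dim_eq_0[of "W i"] by (metis singletonI subsetI zero_neq_numeral)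
  define e where "e = e0 /\<^sub>R norm e0"
  have e: "e \<in> W i"
    unfolding e_def using sub e0(1) by (rule subspace_scale)
  have "norm e = 1" using e0(2) by (simp add: e_def)
  then have ee: "e \<bullet> e = 1" by (simp add: dot_square_norm)
  define b where "b k = orth_proj (W k) e - s *\<^sub>R e" for k
  have pe: "orth_proj (W k) e \<bullet> e = s" "orth_proj (W k) e \<bullet> orth_proj (W k) e = s"
    if "k \<in> ?J" for k
    using isoclinic_inner[OF iso[of i k] e e] that i ee by auto
  let ?S = "{y \<in> UNIV. \<forall>x\<in>W i. orthogonal x y}"
  have "dim ?S + dim (W i) = dim (UNIV :: (real ^ 4) set)"
    by (rule dim_subspace_orthogonal_to_vectors) (use sub in auto)
  then have dS: "dim ?S < card ?J" using dims[OF i] J by simp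
  have bS: "b ` ?J \<subseteq> ?S"
  proof clarsimp
    fix k x assume k: "k \<in> I" "k \<noteq> i" and x: "x \<in> W i"
    have "orth_proj (W k) e \<bullet> x = s * (e \<bullet> x)"
      using isoclinic_inner(1)[OF iso[of i k] e x] i k by auto
    then show "orthogonal x (b k)"
      by (simp add: orthogonal_def b_def inner_diff_right inner_commute)
  qed
  let ?N = "s - s\<^sup>2" and ?M = "(3 * s - 1) / 2 - s\<^sup>2"
  have inner_b: "b k \<bullet> b l = orth_proj (W k) e \<bullet> orth_proj (W l) e - s\<^sup>2"
    if "k \<in> ?J" "l \<in> ?J" for k l
    using pe(1)[OF that(1)] pe(1)[OF that(2)] ee
    by (simp add: b_def inner_diff_left inner_diff_right inner_commute power2_eq_square)
  have N: "b k \<bullet> b k = ?N" if "k \<in> ?J" for k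
    using inner_b[OF that that] pe(2)[OF that] by simp
  have M: "b k \<bullet> b l = ?M" if kl: "k \<in> ?J" "l \<in> ?J" "k \<noteq> l" for k l
  proof -
    have "orth_proj (W k) e \<bullet> orth_proj (W l) e = (3 * s - 1) / 2 * (e \<bullet> e)"
      using kl dims pe(2)[of k] pe(2)[of l] ee s1
      by (intro isoclinic_inner_proj iso) auto
    then show ?thesis using inner_b[OF kl(1,2)] ee by simp
  qed
  have "?N + (real (card ?J) - 1) * ?M = 0"
  proof (rule equiangular_dependent[OF _ N M _ bS dS])
    show "?N \<noteq> ?M" using s1 by (simp add: field_simps)
  qed (use fin in auto)
  then have "(1 - s) * (3 * s - 1) = 0"
    using J by (simp add: field_simps power2_eq_square)
  then show ?thesis using s1 by auto
qed

section \<open>Mercedes-Benz frames\<close>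

lemma span_eq_imp_ne:
  fixes u w :: "'a :: real_vector"
  assumes "span {u} \<noteq> span {w}"
  shows "w \<noteq> u" "w \<noteq> - u"
proof -
  show "w \<noteq> u" using assms by auto
  have "span {- u} = span {u}"
    using span_neg[of u "{-u}"] span_neg[of u "{u}"] span_base[of "-u" "{-u}"]
      span_base[of u "{u}"] span_neg[of "-u" "{-u}"]
    by (intro span_eq[THEN iffD2]) auto
  then show "w \<noteq> - u" using assms by auto
qed

text \<open>Coordinates in the plane with respect to an orthonormal basis whose first vector is \<open>u\<close>; the
  second one comes from \<open>w\<close> by the Gram-Schmidt process.\<close>

lemma plane_orthonormal_basis:
  fixes W :: "'a :: euclidean_space set"
  assumes W: "subspace W" "dim W = 2" and uw: "u \<in> W" "w \<in> W"
    and "norm u = 1" "norm w = 1" "w \<noteq> u" "w \<noteq> - u"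
  obtains f where "norm f = 1" "u \<bullet> f = 0" "\<And>x. x \<in> W \<Longrightarrow> \<exists>a b. x = a *\<^sub>R u + b *\<^sub>R f"
proof -
  define g where "g = w - (u \<bullet> w) *\<^sub>R u"
  have uu: "u \<bullet> u = 1" using \<open>norm u = 1\<close> by (simp add: dot_square_norm)
  have "g \<noteq> 0"
  proof
    assume "g = 0"
    then have eq: "w = (u \<bullet> w) *\<^sub>R u" by (simp add: g_def)
    then have "norm w = \<bar>u \<bullet> w\<bar> * norm u" by (metis norm_scaleR)
    then have "u \<bullet> w = 1 \<or> u \<bullet> w = -1" using \<open>norm u = 1\<close> \<open>norm w = 1\<close> by auto
    then show False
    proof
      assume "u \<bullet> w = 1"
      then show False using eq \<open>w \<noteq> u\<close> by simp
    next
      assume "u \<bullet> w = -1"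
      then show False using eq \<open>w \<noteq> - u\<close> by simp
    qed
  qed
  define f where "f = g /\<^sub>R norm g"
  have f: "norm f = 1" using \<open>g \<noteq> 0\<close> by (simp add: f_def)
  have uf: "u \<bullet> f = 0" using uu by (simp add: f_def g_def inner_diff_right)
  have fW: "f \<in> W"
    using W(1) uw by (simp add: f_def g_def subspace_scale subspace_diff)
  have ne: "u \<noteq> f" using uf uu by auto
  have "independent {u, f}"
  proof (rule pairwise_orthogonal_independent)
    show "pairwise orthogonal {u, f}"
      using uf by (auto simp: pairwise_def orthogonal_def inner_commute)
    show "0 \<notin> {u, f}" using \<open>norm u = 1\<close> f by auto
  qed
  then have WS: "W \<subseteq> span {u, f}"
    using card_ge_dim_independent[of "{u, f}" W] W(2) uw fW ne by simp
  then have "\<exists>a b. x = a *\<^sub>R u + b *\<^sub>R f" if "x \<in> W" for x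
  proof -
    have "x \<in> span {u, f}" using WS that by blast
    then obtain a b where "x - a *\<^sub>R u = b *\<^sub>R f"
      by (auto simp: span_insert span_singleton)
    then have "x = a *\<^sub>R u + b *\<^sub>R f" by (simp add: algebra_simps)
    then show ?thesis by blast
  qed
  then show thesis using that f uf by blast
qed

text \<open>The vectors \<open>(1, 0)\<close>, \<open>(a, b)\<close> and \<open>(c, d)\<close> are the frame in these coordinates. Equality of the
  first two angles leaves only the mirror image of \<open>(a, b)\<close>, up to sign, for \<open>(c, d)\<close>; the third angle
  then gives \<open>\<bar>2 a\<^sup>2 - 1\<bar> = \<bar>a\<bar>\<close>, whose solution \<open>\<bar>a\<bar> = 1\<close> is excluded since the lines are distinct.\<close>

lemma mercedes_benz_coordinates:
  fixes a b c d :: real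
  assumes "a\<^sup>2 + b\<^sup>2 = 1" "c\<^sup>2 + d\<^sup>2 = 1"
    and "\<bar>a\<bar> = \<bar>c\<bar>" "\<bar>c\<bar> = \<bar>a * c + b * d\<bar>" and "b \<noteq> 0"
    and "(c, d) \<noteq> (a, b)" "(c, d) \<noteq> (- a, - b)"
  shows "a\<^sup>2 = 1 / 4" "(c = a \<and> d = - b) \<or> (c = - a \<and> d = b)"
proof -
  have ac: "c = a \<or> c = - a" using assms(3) by (auto simp: abs_if split: if_splits)
  then have "d\<^sup>2 = b\<^sup>2" using assms(1,2) by auto
  then have "d = b \<or> d = - b" by (simp add: power2_eq_iff)
  with ac show cd: "(c = a \<and> d = - b) \<or> (c = - a \<and> d = b)"
    using assms(6,7) by auto
  have b: "b\<^sup>2 = 1 - a\<^sup>2" using assms(1) by simp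
  have "a * c + b * d = a\<^sup>2 - b\<^sup>2 \<or> a * c + b * d = b\<^sup>2 - a\<^sup>2"
    using cd by (auto simp: power2_eq_square)
  then have "\<bar>a\<bar> = \<bar>a\<^sup>2 - b\<^sup>2\<bar>"
    using assms(3,4) by (auto simp: abs_minus_commute)
  then have "a\<^sup>2 = (a\<^sup>2 - b\<^sup>2)\<^sup>2" by (metis power2_abs)
  then have "(1 - a\<^sup>2) * (4 * a\<^sup>2 - 1) = 0"
    unfolding b by (simp add: power2_eq_square algebra_simps)
  then show "a\<^sup>2 = 1 / 4" using b \<open>b \<noteq> 0\<close> by auto
qed

lemma mercedes_benz_sum_power4:
  fixes W :: "(real ^ 'd) set"
  assumes "mercedes_benz_frame W u1 u2 u3" "x \<in> W"
  shows "(u1 \<bullet> x) ^ 4 + (u2 \<bullet> x) ^ 4 + (u3 \<bullet> x) ^ 4 = 9 / 8 * (x \<bullet> x)\<^sup>2"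
proof -
  note mb = assms(1)[unfolded mercedes_benz_frame_def]
  have spans: "span {u1} \<noteq> span {u2}" "span {u2} \<noteq> span {u3}"
    using mb by - (elim conjE, assumption)+
  have W: "subspace W" "dim W = 2" and uW: "u1 \<in> W" "u2 \<in> W" "u3 \<in> W"
    and n: "norm u1 = 1" "norm u2 = 1" "norm u3 = 1"
    and eq: "\<bar>u1 \<bullet> u2\<bar> = \<bar>u1 \<bullet> u3\<bar>" "\<bar>u1 \<bullet> u3\<bar> = \<bar>u2 \<bullet> u3\<bar>"
    using mb by - (elim conjE, assumption)+
  note ne = span_eq_imp_ne[OF spans(1)] span_eq_imp_ne[OF spans(2)]
  obtain f where f: "norm f = 1" "u1 \<bullet> f = 0"
    and coord: "\<And>x. x \<in> W \<Longrightarrow> \<exists>a b. x = a *\<^sub>R u1 + b *\<^sub>R f"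
    by (rule plane_orthonormal_basis[OF W uW(1,2) n(1,2) ne(1,2)]) (rule that; blast)
  obtain a b where ab: "u2 = a *\<^sub>R u1 + b *\<^sub>R f" using coord[OF uW(2)] by blast
  obtain c d where cd: "u3 = c *\<^sub>R u1 + d *\<^sub>R f" using coord[OF uW(3)] by blast
  obtain p q where pq: "x = p *\<^sub>R u1 + q *\<^sub>R f" using coord[OF assms(2)] by blast
  have inner: "(y *\<^sub>R u1 + z *\<^sub>R f) \<bullet> (y' *\<^sub>R u1 + z' *\<^sub>R f) = y * y' + z * z'" for y z y' z'
    using f n(1) by (simp add: inner_add_left inner_add_right inner_commute dot_square_norm)
  have inner1: "u1 \<bullet> (y *\<^sub>R u1 + z *\<^sub>R f) = y" for y z
    using inner[of 1 0 y z] by simp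
  have norms: "a\<^sup>2 + b\<^sup>2 = 1" "c\<^sup>2 + d\<^sup>2 = 1"
    using n(2,3) inner[of a b a b] inner[of c d c d]
    by (simp_all add: ab cd power2_eq_square norm_eq_sqrt_inner)
  have "b \<noteq> 0"
  proof
    assume "b = 0"
    then have "a = 1 \<or> a = -1" using norms(1) by (simp add: power2_eq_1_iff)
    then show False using ne(1,2) \<open>b = 0\<close> by (auto simp: ab)
  qed
  have "\<bar>a\<bar> = \<bar>c\<bar>" "\<bar>c\<bar> = \<bar>a * c + b * d\<bar>"
    using eq by (simp_all add: ab cd inner inner1)
  moreover have "(c, d) \<noteq> (a, b)" "(c, d) \<noteq> (- a, - b)"
    using ne(3,4) by (auto simp: ab cd)
  ultimately have a: "a\<^sup>2 = 1 / 4" and cases: "(c = a \<and> d = - b) \<or> (c = - a \<and> d = b)"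
    by - (rule mercedes_benz_coordinates[OF norms _ _ \<open>b \<noteq> 0\<close>]; assumption)+
  have b: "b\<^sup>2 = 3 / 4" using norms(1) a by simp
  have ux: "u1 \<bullet> x = p" "u2 \<bullet> x = a * p + b * q" "u3 \<bullet> x = c * p + d * q" "x \<bullet> x = p\<^sup>2 + q\<^sup>2"
    by (simp_all add: ab cd pq inner inner1 power2_eq_square)
  have "(c * p + d * q) ^ 4 = (a * p - b * q) ^ 4"
    using cases
  proof
    assume "c = - a \<and> d = b"
    then have "c * p + d * q = - (a * p - b * q)" by simp
    then show ?thesis by (simp only: power_minus_even even_numeral)
  qed simp
  \<comment> \<open>The odd powers of \<open>q\<close> cancel by the mirror symmetry; the fourth powers add up to
    \<open>9/8 p\<^sup>4 + 9/4 p\<^sup>2 q\<^sup>2 + 9/8 q\<^sup>4\<close>, a multiple of a square.\<close>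
  then have "p ^ 4 + (a * p + b * q) ^ 4 + (c * p + d * q) ^ 4 =
      p ^ 4 + 2 * (a\<^sup>2)\<^sup>2 * p ^ 4 + 12 * a\<^sup>2 * b\<^sup>2 * p\<^sup>2 * q\<^sup>2 + 2 * (b\<^sup>2)\<^sup>2 * q ^ 4"
    by (simp add: power2_eq_square power4_eq_xxxx algebra_simps)
  also have "\<dots> = 9 / 8 * (p\<^sup>2 + q\<^sup>2)\<^sup>2"
    unfolding a b by (simp add: power2_eq_square power4_eq_xxxx field_simps)
  finally show ?thesis by (simp add: ux)
qed

section \<open>The design\<close>

lemma sum_triples:
  fixes f :: "nat \<Rightarrow> 'a :: comm_monoid_add"
  shows "(\<Sum>j=1..3 * n. f j) = (\<Sum>m=1..n. f (3 * m - 2) + f (3 * m - 1) + f (3 * m))"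
proof (induction n)
  case (Suc n)
  have "3 * Suc n = Suc (Suc (Suc (3 * n)))" by simp
  moreover have "3 * Suc n - 2 = Suc (3 * n)" "3 * Suc n - 1 = Suc (Suc (3 * n))" by simp_all
  ultimately show ?case using Suc by (simp only: sum.cl_ivl_Suc) (simp add: add.assoc)
qed simp

theorem theorem4p1:
  fixes W :: "nat \<Rightarrow> (real ^ 4) set" and v :: "nat \<Rightarrow> real ^ 4"
  assumes "equi_isoclinic_planes {1..4} W"
    and "inj_on W {1..4}"
    and "\<And>m. m \<in> {1..4} \<Longrightarrow>
           mercedes_benz_frame (W m) (v (3 * m - 2)) (v (3 * m - 1)) (v (3 * m))"
  shows "spherical_tt_design 2 12 v"
proof -
  have sub: "subspace (W m)" and dims: "dim (W m) = 2" if "m \<in> {1..4}" for m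
    using assms(1) that by (auto simp: equi_isoclinic_planes_def)
  obtain s where iso: "\<And>j k. j \<in> {1..4} \<Longrightarrow> k \<in> {1..4} \<Longrightarrow> j \<noteq> k \<Longrightarrow> isoclinic s (W j) (W k)"
    by (rule equi_isoclinic_planes_isoclinic[OF assms(1)]) (rule that; blast)
  have s: "s = 1 / 3"
    by (rule four_isoclinic_planes_parameter[OF _ assms(2) dims iso]) simp_all
  have frame_sum: "(\<Sum>k=1..12. (x \<bullet> v k) ^ 4) = 3 / 2"
    if m: "m \<in> {1..4}" and x: "x \<in> W m" "norm x = 1" for m x
  proof -
    have xx: "x \<bullet> x = 1" using x by (simp add: dot_square_norm)
    \<comment> \<open>The frame of another plane sees a vector of squared norm \<open>1/3\<close>, and \<open>9/8 (1/3)\<^sup>2 = 1/8\<close>.\<close>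
    have part: "(x \<bullet> v (3 * l - 2)) ^ 4 + (x \<bullet> v (3 * l - 1)) ^ 4 + (x \<bullet> v (3 * l)) ^ 4 =
        (if l = m then 9 / 8 else 1 / 8)" if l: "l \<in> {1..4}" for l
    proof -
      let ?p = "orth_proj (W l) x"
      note mb = assms(3)[OF l]
      have "u \<bullet> ?p = x \<bullet> u" if "u \<in> W l" for u
        using orth_proj_inner[OF sub[OF l] that, of x] by (simp add: inner_commute)
      then have "(x \<bullet> v (3 * l - 2)) ^ 4 + (x \<bullet> v (3 * l - 1)) ^ 4 + (x \<bullet> v (3 * l)) ^ 4 =
          9 / 8 * (?p \<bullet> ?p)\<^sup>2"
        using mercedes_benz_sum_power4[OF mb orth_proj_in[OF sub[OF l], of x]] mb
        by (simp add: mercedes_benz_frame_def)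
      moreover have "?p \<bullet> ?p = (if l = m then 1 else 1 / 3)"
        using isoclinic_inner(2)[OF iso[OF m l] x(1) x(1)] x(1) orth_proj_fixed[OF sub[OF m]]
        by (auto simp: xx s)
      moreover have "9 / 8 * (if l = m then 1 else 1 / 3)\<^sup>2 = (if l = m then 9 / 8 else 1 / 8 :: real)"
        by (simp add: power2_eq_square)
      ultimately show ?thesis by (simp only:)
    qed
    have "(\<Sum>k=1..12. (x \<bullet> v k) ^ 4) = (\<Sum>l=1..4. if l = m then 9 / 8 else 1 / 8)"
    proof -
      have "(\<Sum>k=1..3 * 4. (x \<bullet> v k) ^ 4) = (\<Sum>l=1..4. if l = m then 9 / 8 else 1 / 8)"
        unfolding sum_triples by (rule sum.cong[OF refl part])
      then show ?thesis by simp
    qed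
    also have "\<dots> = (\<Sum>l=1..4::nat. 1 / 8 + (if l = m then 1 else 0))"
      by (intro sum.cong) auto
    also have "\<dots> = 3 / 2"
      using m by (simp add: sum.distrib)
    finally show ?thesis .
  qed
  have plane: "\<exists>m\<in>{1..4}. v j \<in> W m \<and> norm (v j) = 1" if "j \<in> {1..12}" for j
  proof -
    define m where "m = (j + 2) div 3"
    have m: "m \<in> {1..4}" using that by (auto simp: m_def)
    have "j = 3 * m - 2 \<or> j = 3 * m - 1 \<or> j = 3 * m"
      using that unfolding m_def atLeastAtMost_iff by presburger
    then show ?thesis
      using assms(3)[OF m] m unfolding mercedes_benz_frame_def by blast
  qed
  have "(\<Sum>k=1..12. (v j \<bullet> v k) ^ 4) = 3 / 2" if "j \<in> {1..12}" for j
    using plane[OF that] frame_sum by blast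
  then have "(\<Sum>j=1..12. \<Sum>k=1..12. (v j \<bullet> v k) ^ 4) = (\<Sum>j=1..12::nat. 3 / 2)"
    by (rule sum.cong[OF refl])
  then have lhs: "(\<Sum>j=1..12. \<Sum>k=1..12. (v j \<bullet> v k) ^ 4) = 18" by simp
  have n1: "norm (v l) = 1" if "l \<in> {1..12}" for l using plane[OF that] by blast
  have "(\<Sum>l=1..12. norm (v l) ^ 4) = (\<Sum>l=1..12::nat. 1)"
    by (rule sum.cong[OF refl]) (simp only: n1 power_one)
  then have rhs: "(\<Sum>l=1..12. norm (v l) ^ 4) = 12" by simp
  have const: "(\<Prod>i<2. 2 * real i + 1) / (\<Prod>i<2. real CARD(4) + 2 * real i) = 1 / 8"
    by (simp add: numeral_2_eq_2)
  have "v 1 \<noteq> 0" using n1[of 1] by force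
  then have "\<exists>j\<in>{1..12}. v j \<noteq> 0" by (intro bexI[of _ 1]) simp_all
  moreover have "\<bar>y\<bar> ^ (2 * 2) = y ^ 4" "y ^ (2 * 2) = y ^ 4" for y :: real by simp_all
  ultimately show ?thesis
    unfolding spherical_tt_design_def const by (simp only: lhs rhs) simp
qed

end
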